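(* Let $d\ge1$ and $m\ge 0$ be integers, let $\beta^{(m)}=\{\beta_i\}_{i\in\mathbb{Z}_+^d,\,|i|\le m}$ be a real multisequence, and let $K\subseteq\mathbb{R}^d$ be closed. If the convex set $M_K(\beta^{(m)})$ of representing measures for $\beta^{(m)}$ supported in $K$ has an extreme point $\nu$, then $\nu$ is finitely atomic, with $$\operatorname{card}\operatorname{supp}\nu\le\dim\mathbb{R}_{m,d}[t](\nu)\ \bigl(\le\dim\mathbb{R}_{m,d}[t]|_K\bigr).$$
   Context: For $i=(i_1,\dots,i_d)\in\mathbb{Z}_+^d$ and $t\in\mathbb{R}^d$, $t^i=t_1^{i_1}\cdots t_d^{i_d}$ and $|i|=i_1+\cdots+i_d$. A representing measure for $\beta^{(m)}$ is a positive Borel measure $\mu$ on $\mathbb{R}^d$ with $\beta_i=\int t^i\,d\mu(t)$ for all $|i|\le m$ (all these monomials being absolutely integrable). $M_K(\beta^{(m)})$ is the set of representing measures $\nu$ for $\beta^{(m)}$ with closed support $\operatorname{supp}\nu\subseteq K$. $\mathbb{R}_{m,d}[t]$ is the space of real polynomials in $t_1,\dots,t_d$ of total degree at most $m$; $\mathbb{R}_{m,d}[t](\nu)$ is its image in $L^1(\nu)$ under the canonical map (polynomial $\mapsto$ $\nu$-a.e. class); $\mathbb{R}_{m,d}[t]|_K$ is the vector space of restrictions to $K$ of elements of $\mathbb{R}_{m,d}[t]$. A measure is finitely atomic if it is a finite sum $\sum_{k}\rho_k\delta_{x_k}$ with $\rho_k>0$ and $\delta_{x_k}$ point masses. *)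

theory Defs
  imports "HOL-Probability.Probability" "Jordan_Normal_Form.Missing_VectorSpace"
begin

subsection \<open>Monomials and polynomials\<close>

definition multi_abs :: "nat ^ 'd \<Rightarrow> nat" where
  "multi_abs i = (\<Sum>k\<in>UNIV. i $ k)"

definition multi_power :: "real ^ 'd \<Rightarrow> nat ^ 'd \<Rightarrow> real" where
  "multi_power t i = (\<Prod>k\<in>UNIV. (t $ k) ^ (i $ k))"

(* Since the real field is infinite, a real polynomial is determined by its polynomial
   function, so polynomials are represented by their polynomial functions. *)
definition polys :: "nat \<Rightarrow> (real ^ 'd \<Rightarrow> real) set" where
  "polys m = {(\<lambda>t. \<Sum>i\<in>{i. multi_abs i \<le> m}. c i * multi_power t i) |c. True}"

lemma finite_multi_abs_le: "finite {i :: nat ^ 'd. multi_abs i \<le> m}"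
proof -
  have "i $ k \<le> m" if "multi_abs i \<le> m" for i :: "nat ^ 'd" and k
    using that member_le_sum[of k UNIV "\<lambda>k. i $ k"] by (simp add: multi_abs_def)
  hence "vec_nth i \<in> UNIV \<rightarrow>\<^sub>E {..m}" if "multi_abs i \<le> m" for i :: "nat ^ 'd"
    using that by auto
  moreover have "i = vec_lambda (vec_nth i)" for i :: "nat ^ 'd"
    by simp
  ultimately have "{i :: nat ^ 'd. multi_abs i \<le> m} \<subseteq> vec_lambda ` (UNIV \<rightarrow>\<^sub>E {..m})"
    by blast
  thus ?thesis
    by (rule finite_subset) (intro finite_imageI finite_PiE, auto)
qed


subsection \<open>Representing measures\<close>

definition measure_support :: "'a::topological_space measure \<Rightarrow> 'a set" where
  "measure_support \<nu> = {x. \<forall>U. open U \<and> x \<in> U \<longrightarrow> emeasure \<nu> U > 0}"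

(* Only the values of beta at multi-indices of absolute value at most m are relevant. *)
definition representing_measures ::
    "nat \<Rightarrow> (nat ^ 'd \<Rightarrow> real) \<Rightarrow> (real ^ 'd) set \<Rightarrow> (real ^ 'd) measure set" where
  "representing_measures m \<beta> K = {\<mu>. sets \<mu> = sets borel \<and>
     (\<forall>i. multi_abs i \<le> m \<longrightarrow>
        integrable \<mu> (\<lambda>t. multi_power t i) \<and> \<beta> i = (\<integral>t. multi_power t i \<partial>\<mu>)) \<and>
     measure_support \<mu> \<subseteq> K}"

(* Measures do not form a real vector space, so extreme_point_of does not apply. As there,
   an extreme point lies on no open segment between distinct points of the set. *)
definition extreme_measure :: "'a measure \<Rightarrow> 'a measure set \<Rightarrow> bool" where
  "extreme_measure \<nu> M \<longleftrightarrow> \<nu> \<in> M \<and>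
     (\<forall>\<mu>\<^sub>1\<in>M. \<forall>\<mu>\<^sub>2\<in>M. \<forall>u::real. 0 < u \<and> u < 1 \<and>
        (\<forall>A\<in>sets \<nu>. emeasure \<nu> A =
           ennreal (1 - u) * emeasure \<mu>\<^sub>1 A + ennreal u * emeasure \<mu>\<^sub>2 A)
        \<longrightarrow> \<mu>\<^sub>1 = \<mu>\<^sub>2)"

definition finitely_atomic :: "'a::topological_space measure \<Rightarrow> bool" where
  "finitely_atomic \<nu> \<longleftrightarrow> sets \<nu> = sets borel \<and>
     (\<exists>(n::nat) \<rho> x. (\<forall>k<n. (0::real) < \<rho> k) \<and>
        (\<forall>A\<in>sets borel. emeasure \<nu> A =
           (\<Sum>k<n. ennreal (\<rho> k) * emeasure (return borel (x k)) A)))"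

lemma multi_abs_zero: "multi_abs (0 :: nat ^ 'd) = 0"
  by (simp add: multi_abs_def)

lemma multi_power_zero: "multi_power t 0 = 1"
  by (simp add: multi_power_def)

lemma representing_measures_finite:
  assumes "\<mu> \<in> representing_measures m \<beta> K"
  shows "finite_measure \<mu>"
proof -
  have "integrable \<mu> (\<lambda>t. multi_power t 0)"
    using assms by (auto simp: representing_measures_def multi_abs_zero)
  hence "integrable \<mu> (\<lambda>_. 1 :: real)"
    by (simp add: multi_power_zero)
  hence "emeasure \<mu> (space \<mu>) < \<infinity>"
    using integrable_indicator_iff[of \<mu> "space \<mu>"]
    by (simp add: integrable_iff_bounded)
  thus ?thesis by (intro finite_measureI) auto
qed

lemma polys_integrable:
  assumes "\<mu> \<in> representing_measures m \<beta> K" and "p \<in> polys m"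
  shows "integrable \<mu> p"
  using assms unfolding polys_def representing_measures_def
  by (auto intro!: Bochner_Integration.integrable_sum)


subsection \<open>Vector spaces of functions and of classes of functions\<close>

definition real_ring :: "real ring" where
  "real_ring = \<lparr>carrier = UNIV, mult = (*), one = 1, zero = 0, add = (+)\<rparr>"

definition ae_class :: "'a measure \<Rightarrow> ('a \<Rightarrow> real) \<Rightarrow> ('a \<Rightarrow> real) set" where
  "ae_class \<nu> f = {g \<in> borel_measurable \<nu>. AE x in \<nu>. g x = f x}"

(* All classes in the unions below coincide; cf. the lemmas L1_space_add and L1_space_smult.
   The fields mult and one belong to the record type of modules but play no role here. *)
definition L1_space :: "'a measure \<Rightarrow> (real, ('a \<Rightarrow> real) set) module" where
  "L1_space \<nu> = \<lparr>carrier = ae_class \<nu> ` {f. integrable \<nu> f},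
     mult = undefined, one = undefined,
     zero = ae_class \<nu> (\<lambda>x. 0),
     add = (\<lambda>F G. \<Union>f\<in>F. \<Union>g\<in>G. ae_class \<nu> (\<lambda>x. f x + g x)),
     smult = (\<lambda>c F. \<Union>f\<in>F. ae_class \<nu> (\<lambda>x. c * f x))\<rparr>"

(* A function on K is represented by its extension to the whole type with the value
   undefined outside K. *)
definition function_space :: "'a set \<Rightarrow> (real, 'a \<Rightarrow> real) module" where
  "function_space K = \<lparr>carrier = extensional K,
     mult = undefined, one = undefined,
     zero = (\<lambda>x\<in>K. 0),
     add = (\<lambda>f g. \<lambda>x\<in>K. f x + g x),
     smult = (\<lambda>c f. \<lambda>x\<in>K. c * f x)\<rparr>"

definition polys_L1 :: "nat \<Rightarrow> (real ^ 'd) measure \<Rightarrow> (real, (real ^ 'd \<Rightarrow> real) set) module" where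
  "polys_L1 m \<nu> = (L1_space \<nu>)\<lparr>carrier := ae_class \<nu> ` polys m\<rparr>"

definition polys_restr :: "nat \<Rightarrow> (real ^ 'd) set \<Rightarrow> (real, real ^ 'd \<Rightarrow> real) module" where
  "polys_restr m K = (function_space K)\<lparr>carrier := (\<lambda>p. restrict p K) ` polys m\<rparr>"

abbreviation real_dim :: "(real, 'v) module \<Rightarrow> nat" where
  "real_dim V \<equiv> vectorspace.dim real_ring V"

lemma field_real_ring: "field real_ring"
proof (rule cring.cring_fieldI2)
  show "cring real_ring"
  proof (rule cringI)
    have "\<exists>y\<in>carrier real_ring. y \<oplus>\<^bsub>real_ring\<^esub> x = \<zero>\<^bsub>real_ring\<^esub>" for x
      by (rule bexI[of _ "- x"]) (simp_all add: real_ring_def)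
    thus "abelian_group real_ring"
      by (intro abelian_groupI) (simp_all add: real_ring_def)
    show "comm_monoid real_ring"
      by (rule comm_monoidI) (simp_all add: real_ring_def)
  qed (simp add: real_ring_def distrib_right)
  show "\<zero>\<^bsub>real_ring\<^esub> \<noteq> \<one>\<^bsub>real_ring\<^esub>"
    by (simp add: real_ring_def)
  show "\<exists>b\<in>carrier real_ring. a \<otimes>\<^bsub>real_ring\<^esub> b = \<one>\<^bsub>real_ring\<^esub>"
    if "a \<in> carrier real_ring" "a \<noteq> \<zero>\<^bsub>real_ring\<^esub>" for a
    using that by (intro bexI[of _ "inverse a"]) (auto simp: real_ring_def)
qed

lemma ae_class_eq_iff:
  assumes "f \<in> borel_measurable \<nu>" "g \<in> borel_measurable \<nu>"
  shows "ae_class \<nu> f = ae_class \<nu> g \<longleftrightarrow> (AE x in \<nu>. f x = g x)"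
proof
  assume "ae_class \<nu> f = ae_class \<nu> g"
  moreover have "f \<in> ae_class \<nu> f" using assms by (simp add: ae_class_def)
  ultimately show "AE x in \<nu>. f x = g x" by (simp add: ae_class_def)
next
  assume fg: "AE x in \<nu>. f x = g x"
  have "(AE x in \<nu>. h x = f x) \<longleftrightarrow> (AE x in \<nu>. h x = g x)" for h
    using fg by (auto elim: eventually_elim2)
  thus "ae_class \<nu> f = ae_class \<nu> g" by (simp add: ae_class_def)
qed

lemma L1_space_add:
  assumes [measurable]: "f \<in> borel_measurable \<nu>" "g \<in> borel_measurable \<nu>"
  shows "ae_class \<nu> f \<oplus>\<^bsub>L1_space \<nu>\<^esub> ae_class \<nu> g = ae_class \<nu> (\<lambda>x. f x + g x)"
proof -
  have "ae_class \<nu> (\<lambda>x. f' x + g' x) = ae_class \<nu> (\<lambda>x. f x + g x)"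
    if "f' \<in> ae_class \<nu> f" "g' \<in> ae_class \<nu> g" for f' g'
  proof -
    have [measurable]: "f' \<in> borel_measurable \<nu>" "g' \<in> borel_measurable \<nu>"
      and "AE x in \<nu>. f' x = f x" "AE x in \<nu>. g' x = g x"
      using that by (auto simp: ae_class_def)
    from this(3,4) have "AE x in \<nu>. f' x + g' x = f x + g x" by eventually_elim simp
    thus ?thesis by (subst ae_class_eq_iff) auto
  qed
  moreover have "f \<in> ae_class \<nu> f" "g \<in> ae_class \<nu> g" by (auto simp: ae_class_def)
  ultimately have "(\<Union>f'\<in>ae_class \<nu> f. \<Union>g'\<in>ae_class \<nu> g. ae_class \<nu> (\<lambda>x. f' x + g' x)) =
      ae_class \<nu> (\<lambda>x. f x + g x)"
    by blast
  thus ?thesis by (simp add: L1_space_def)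
qed

lemma L1_space_smult:
  assumes [measurable]: "f \<in> borel_measurable \<nu>"
  shows "c \<odot>\<^bsub>L1_space \<nu>\<^esub> ae_class \<nu> f = ae_class \<nu> (\<lambda>x. c * f x)"
proof -
  have "ae_class \<nu> (\<lambda>x. c * f' x) = ae_class \<nu> (\<lambda>x. c * f x)" if "f' \<in> ae_class \<nu> f" for f'
  proof -
    have [measurable]: "f' \<in> borel_measurable \<nu>" and "AE x in \<nu>. f' x = f x"
      using that by (auto simp: ae_class_def)
    from this(2) have "AE x in \<nu>. c * f' x = c * f x" by eventually_elim simp
    thus ?thesis by (subst ae_class_eq_iff) auto
  qed
  moreover have "f \<in> ae_class \<nu> f" by (auto simp: ae_class_def)
  ultimately have "(\<Union>f'\<in>ae_class \<nu> f. ae_class \<nu> (\<lambda>x. c * f' x)) = ae_class \<nu> (\<lambda>x. c * f x)"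
    by blast
  thus ?thesis by (simp add: L1_space_def)
qed

lemma vectorspace_function_imageI:
  fixes V :: "(real, 'v) module" and q :: "('a \<Rightarrow> real) \<Rightarrow> 'v"
  assumes car: "carrier V = q ` P" and zeroV: "\<zero>\<^bsub>V\<^esub> = q (\<lambda>x. 0)"
    and addV: "\<And>f g. f \<in> P \<Longrightarrow> g \<in> P \<Longrightarrow> q f \<oplus>\<^bsub>V\<^esub> q g = q (\<lambda>x. f x + g x)"
    and smultV: "\<And>c f. f \<in> P \<Longrightarrow> c \<odot>\<^bsub>V\<^esub> q f = q (\<lambda>x. c * f x)"
    and zero: "(\<lambda>x. 0) \<in> P"
    and add: "\<And>f g. f \<in> P \<Longrightarrow> g \<in> P \<Longrightarrow> (\<lambda>x. f x + g x) \<in> P"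
    and smult: "\<And>c f. f \<in> P \<Longrightarrow> (\<lambda>x. c * f x) \<in> P"
  shows "vectorspace real_ring V"
proof -
  have inv: "\<exists>v\<in>q ` P. v \<oplus>\<^bsub>V\<^esub> q f = q (\<lambda>x. 0)" if "f \<in> P" for f
    using that smult[OF that, of "-1"] addV[of "\<lambda>x. - 1 * f x" f]
    by (intro bexI[of _ "q (\<lambda>x. - 1 * f x)"]) auto
  have ab: "abelian_group V"
  proof (rule abelian_groupI)
    fix x assume "x \<in> carrier V"
    thus "\<exists>y\<in>carrier V. y \<oplus>\<^bsub>V\<^esub> x = \<zero>\<^bsub>V\<^esub>"
      using inv unfolding car zeroV by blast
  qed (auto simp: car zeroV addV add zero add_ac)
  have "Module.module real_ring V"
  proof (rule moduleI)
    show "cring real_ring"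
      using field_real_ring by (simp add: field_def domain_def)
    show "abelian_group V" by (fact ab)
  next
    fix a x assume "x \<in> carrier V"
    then obtain f where x: "x = q f" and f: "f \<in> P"
      unfolding car by blast
    show "a \<odot>\<^bsub>V\<^esub> x \<in> carrier V"
      using f by (simp add: x car smultV smult)
    show "(a \<oplus>\<^bsub>real_ring\<^esub> b) \<odot>\<^bsub>V\<^esub> x = a \<odot>\<^bsub>V\<^esub> x \<oplus>\<^bsub>V\<^esub> b \<odot>\<^bsub>V\<^esub> x" for b
      using f by (simp add: x smultV addV smult real_ring_def distrib_right)
    show "(a \<otimes>\<^bsub>real_ring\<^esub> b) \<odot>\<^bsub>V\<^esub> x = a \<odot>\<^bsub>V\<^esub> (b \<odot>\<^bsub>V\<^esub> x)" for b
      using f by (simp add: x smultV smult real_ring_def mult.assoc)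
    show "\<one>\<^bsub>real_ring\<^esub> \<odot>\<^bsub>V\<^esub> x = x"
      using f by (simp add: x smultV real_ring_def)
    fix y assume "y \<in> carrier V"
    then obtain g where y: "y = q g" and g: "g \<in> P"
      unfolding car by blast
    show "a \<odot>\<^bsub>V\<^esub> (x \<oplus>\<^bsub>V\<^esub> y) = a \<odot>\<^bsub>V\<^esub> x \<oplus>\<^bsub>V\<^esub> a \<odot>\<^bsub>V\<^esub> y"
      using f g by (simp add: x y smultV addV smult add distrib_left)
  qed
  thus ?thesis
    using field_real_ring by (simp add: vectorspace_def)
qed

lemma vectorspace_L1_space: "vectorspace real_ring (L1_space \<nu>)"
proof (rule vectorspace_function_imageI[where q = "ae_class \<nu>" and P = "{f. integrable \<nu> f}"])
  show "carrier (L1_space \<nu>) = ae_class \<nu> ` {f. integrable \<nu> f}"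
    and "\<zero>\<^bsub>L1_space \<nu>\<^esub> = ae_class \<nu> (\<lambda>x. 0)"
    by (simp_all add: L1_space_def)
qed (simp_all add: L1_space_add L1_space_smult)

lemma polysI: "(\<lambda>t. \<Sum>i\<in>{i. multi_abs i \<le> m}. c i * multi_power t i) \<in> polys m"
  unfolding polys_def by (rule CollectI, rule exI[of _ c]) simp

lemma polys_zero: "(\<lambda>t. 0) \<in> polys m"
  using polysI[of "\<lambda>_. 0" m] by simp

lemma polys_add:
  assumes "p \<in> polys m" "q \<in> polys m"
  shows "(\<lambda>t. p t + q t) \<in> polys m"
proof -
  from assms obtain a b where "p = (\<lambda>t. \<Sum>i\<in>{i. multi_abs i \<le> m}. a i * multi_power t i)"
    "q = (\<lambda>t. \<Sum>i\<in>{i. multi_abs i \<le> m}. b i * multi_power t i)"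
    unfolding polys_def by blast
  hence "(\<lambda>t. p t + q t) =
      (\<lambda>t. \<Sum>i\<in>{i. multi_abs i \<le> m}. (a i + b i) * multi_power t i)"
    by (simp add: sum.distrib distrib_right)
  thus ?thesis by (simp only: polysI)
qed

lemma polys_smult:
  assumes "p \<in> polys m"
  shows "(\<lambda>t. c * p t) \<in> polys m"
proof -
  from assms obtain a where "p = (\<lambda>t. \<Sum>i\<in>{i. multi_abs i \<le> m}. a i * multi_power t i)"
    unfolding polys_def by blast
  hence "(\<lambda>t. c * p t) =
      (\<lambda>t. \<Sum>i\<in>{i. multi_abs i \<le> m}. (c * a i) * multi_power t i)"
    by (simp add: sum_distrib_left mult.assoc)
  thus ?thesis by (simp only: polysI)
qed

lemma vectorspace_polys_L1:
  assumes "\<nu> \<in> representing_measures m \<beta> K"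
  shows "vectorspace real_ring (polys_L1 m \<nu>)"
    and "carrier (polys_L1 m \<nu>) \<subseteq> carrier (L1_space \<nu>)"
proof -
  have meas: "p \<in> borel_measurable \<nu>" if "p \<in> polys m" for p
    using polys_integrable[OF assms that] by auto
  show "vectorspace real_ring (polys_L1 m \<nu>)"
  proof (rule vectorspace_function_imageI[where q = "ae_class \<nu>" and P = "polys m"])
    show "carrier (polys_L1 m \<nu>) = ae_class \<nu> ` polys m"
      by (simp add: polys_L1_def)
    show "\<zero>\<^bsub>polys_L1 m \<nu>\<^esub> = ae_class \<nu> (\<lambda>x. 0)"
      by (simp add: polys_L1_def L1_space_def)
    show "ae_class \<nu> f \<oplus>\<^bsub>polys_L1 m \<nu>\<^esub> ae_class \<nu> g = ae_class \<nu> (\<lambda>x. f x + g x)"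
      if "f \<in> polys m" "g \<in> polys m" for f g
      using L1_space_add[OF meas meas, OF that] by (simp add: polys_L1_def)
    show "c \<odot>\<^bsub>polys_L1 m \<nu>\<^esub> ae_class \<nu> f = ae_class \<nu> (\<lambda>x. c * f x)"
      if "f \<in> polys m" for c f
      using L1_space_smult[OF meas, OF that] by (simp add: polys_L1_def)
  qed (simp_all add: polys_zero polys_add polys_smult)
  show "carrier (polys_L1 m \<nu>) \<subseteq> carrier (L1_space \<nu>)"
    using polys_integrable[OF assms] by (auto simp: polys_L1_def L1_space_def)
qed

lemma vectorspace_polys_restr: "vectorspace real_ring (polys_restr m K)"
proof (rule vectorspace_function_imageI[where q = "\<lambda>p. restrict p K" and P = "polys m"])
  show "restrict f K \<oplus>\<^bsub>polys_restr m K\<^esub> restrict g K = restrict (\<lambda>x. f x + g x) K" for f g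
    by (auto simp: polys_restr_def function_space_def fun_eq_iff)
  show "c \<odot>\<^bsub>polys_restr m K\<^esub> restrict f K = restrict (\<lambda>x. c * f x) K" for c f
    by (auto simp: polys_restr_def function_space_def fun_eq_iff)
  show "carrier (polys_restr m K) = (\<lambda>p. restrict p K) ` polys m"
    by (simp add: polys_restr_def)
  show "\<zero>\<^bsub>polys_restr m K\<^esub> = restrict (\<lambda>x. 0) K"
    by (simp add: polys_restr_def function_space_def)
qed (simp_all add: polys_zero polys_add polys_smult)

end

theory Submission
  imports Defs
begin

text \<open>
  If a bounded measurable function \<open>h\<close> satisfies \<open>\<integral>h p d\<nu> = 0\<close> for all polynomials \<open>p\<close> of degree at
  most \<open>m\<close>, then for small \<open>\<epsilon>\<close> the measures \<open>(1 \<plusminus> \<epsilon> h) \<nu>\<close> are representing measures with midpoint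
  \<open>\<nu>\<close>, so extremality of \<open>\<nu>\<close> forces \<open>h = 0\<close> almost everywhere. Given more than
  \<open>D = dim \<real>\<^bsub>m,d\<^esub>[t](\<nu>)\<close> disjoint Borel sets of positive measure, the \<open>D\<close> homogeneous linear
  conditions on \<open>h\<close> have a nontrivial solution among the linear combinations of their indicator
  functions, a contradiction. Neighbourhoods of distinct points of the support yield such sets.
\<close>

subsection \<open>Homogeneous linear systems\<close>

text \<open>Gaussian elimination, by induction on the set of equations. An equation whose
  coefficients all vanish on \<open>S\<close> is dropped; any other is solved for one unknown, which
  lowers both counts by one.\<close>

lemma underdetermined_homogeneous_system:
  fixes c :: "'i \<Rightarrow> 'k \<Rightarrow> real"
  assumes "finite I" "finite S" "card I < card S"
  shows "\<exists>x. (\<exists>k\<in>S. x k \<noteq> 0) \<and> (\<forall>i\<in>I. (\<Sum>k\<in>S. c i k * x k) = 0)"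
  using assms
proof (induction I arbitrary: S c rule: finite_induct)
  case empty
  then obtain k where "k \<in> S" by fastforce
  thus ?case by (intro exI[of _ "\<lambda>_. 1"]) auto
next
  case (insert i I)
  show ?case
  proof (cases "\<forall>k\<in>S. c i k = 0")
    case True
    have "card I < card S" using insert by simp
    from insert.IH[OF insert.prems(1) this, of c] True show ?thesis by auto
  next
    case False
    then obtain l where l: "l \<in> S" "c i l \<noteq> 0" by blast
    let ?S = "S - {l}"
    have "card I < card ?S" using insert l by (simp add: card_Diff_singleton)
    \<comment> \<open>These coefficients result from substituting the solution of equation
      \<open>i\<close> for the unknown \<open>l\<close> into equation \<open>j\<close>.\<close>
    from insert.IH[OF _ this, of "\<lambda>j k. c j k - c j l * c i k / c i l"] insert.prems
    obtain y where y: "\<exists>k\<in>?S. y k \<noteq> 0"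
      "\<And>j. j \<in> I \<Longrightarrow> (\<Sum>k\<in>?S. (c j k - c j l * c i k / c i l) * y k) = 0"
      by auto
    define x where "x = (\<lambda>k. if k = l then - (\<Sum>k\<in>?S. c i k * y k) / c i l else y k)"
    have "(\<Sum>k\<in>S. c j k * x k) = (\<Sum>k\<in>?S. (c j k - c j l * c i k / c i l) * y k)" for j
    proof -
      have "(\<Sum>k\<in>S. c j k * x k) = c j l * x l + (\<Sum>k\<in>?S. c j k * x k)"
        using l insert.prems by (simp add: sum.remove)
      also have "(\<Sum>k\<in>?S. c j k * x k) = (\<Sum>k\<in>?S. c j k * y k)"
        by (intro sum.cong) (auto simp: x_def)
      also have "c j l * x l = - (\<Sum>k\<in>?S. c j l * c i k / c i l * y k)"
        by (simp add: x_def sum_distrib_left sum_divide_distrib algebra_simps)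
      finally show ?thesis by (simp add: left_diff_distrib sum_subtractf)
    qed
    \<comment> \<open>For \<open>j = i\<close> the reduced coefficients are identically zero, so
      equation \<open>i\<close> needs nothing from the induction hypothesis.\<close>
    hence "\<forall>j\<in>insert i I. (\<Sum>k\<in>S. c j k * x k) = 0" using y(2) l(2) by simp
    moreover have "\<exists>k\<in>S. x k \<noteq> 0" using y(1) by (auto simp: x_def)
    ultimately show ?thesis by blast
  qed
qed


subsection \<open>Linear images of spaces of functions\<close>

text \<open>Makes \<open>q\<close> a linear map from the function space \<open>P\<close> onto
  \<open>V\<close>. Both \<open>polys_L1\<close> and \<open>polys_restr\<close> arise in this way
  from the same \<open>P\<close>, so they can be treated together and compared through
  representatives.\<close>

locale function_image =
  fixes V :: "(real, 'v) module" and q :: "('a \<Rightarrow> real) \<Rightarrow> 'v" and P :: "('a \<Rightarrow> real) set"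
  assumes carrier_image: "carrier V = q ` P"
    and zero_image: "\<zero>\<^bsub>V\<^esub> = q (\<lambda>x. 0)"
    and add_image: "\<And>f g. f \<in> P \<Longrightarrow> g \<in> P \<Longrightarrow> q f \<oplus>\<^bsub>V\<^esub> q g = q (\<lambda>x. f x + g x)"
    and smult_image: "\<And>c f. f \<in> P \<Longrightarrow> c \<odot>\<^bsub>V\<^esub> q f = q (\<lambda>x. c * f x)"
    and zero_mem: "(\<lambda>x. 0) \<in> P"
    and add_mem: "\<And>f g. f \<in> P \<Longrightarrow> g \<in> P \<Longrightarrow> (\<lambda>x. f x + g x) \<in> P"
    and smult_mem: "\<And>c f. f \<in> P \<Longrightarrow> (\<lambda>x. c * f x) \<in> P"

sublocale function_image \<subseteq> vectorspace real_ring V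
  by (rule vectorspace_function_imageI[where q = q and P = P])
    (fact carrier_image zero_image add_image smult_image zero_mem add_mem smult_mem)+

context function_image
begin

text \<open>The images of the functions satisfying \<open>Q\<close> form a submodule containing
  \<open>A\<close>, hence all of \<open>V\<close>. This only yields some representative of
  \<open>q f\<close> with property \<open>Q\<close>; \<open>cong\<close> carries the property over
  to \<open>f\<close> itself.\<close>

lemma gen_set_induct:
  assumes "f \<in> P" and gen: "gen_set A"
    and base: "\<And>f. f \<in> P \<Longrightarrow> q f \<in> A \<Longrightarrow> Q f"
    and zero: "Q (\<lambda>x. 0)"
    and add: "\<And>f g. f \<in> P \<Longrightarrow> g \<in> P \<Longrightarrow> Q f \<Longrightarrow> Q g \<Longrightarrow> Q (\<lambda>x. f x + g x)"
    and smult: "\<And>c f. f \<in> P \<Longrightarrow> Q f \<Longrightarrow> Q (\<lambda>x. c * f x)"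
    and cong: "\<And>f g. f \<in> P \<Longrightarrow> g \<in> P \<Longrightarrow> q f = q g \<Longrightarrow> Q f \<Longrightarrow> Q g"
    and A: "A \<subseteq> carrier V"
  shows "Q f"
proof -
  let ?N = "q ` {f \<in> P. Q f}"
  have "submodule real_ring ?N V"
  proof (rule submodule.intro)
    show "Module.module real_ring V" ..
    show "?N \<subseteq> carrier V" by (auto simp: carrier_image)
    show "\<zero>\<^bsub>V\<^esub> \<in> ?N" using zero zero_mem by (auto simp: zero_image)
    show "v \<oplus>\<^bsub>V\<^esub> w \<in> ?N" if "v \<in> ?N" "w \<in> ?N" for v w
    proof -
      from that obtain f g where fg: "v = q f" "w = q g" "f \<in> P" "g \<in> P" "Q f" "Q g" by blast
      have "v \<oplus>\<^bsub>V\<^esub> w = q (\<lambda>x. f x + g x)" using fg by (simp add: add_image)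
      thus ?thesis using fg add add_mem by blast
    qed
    show "c \<odot>\<^bsub>V\<^esub> v \<in> ?N" if "v \<in> ?N" for c v
    proof -
      from that obtain f where f: "v = q f" "f \<in> P" "Q f" by blast
      have "c \<odot>\<^bsub>V\<^esub> v = q (\<lambda>x. c * f x)" using f by (simp add: smult_image)
      thus ?thesis using f smult smult_mem by blast
    qed
  qed
  moreover have "A \<subseteq> ?N" using A base unfolding carrier_image by blast
  ultimately have "span A \<subseteq> ?N" by (intro span_is_subset)
  hence "q f \<in> ?N" using gen \<open>f \<in> P\<close> by (auto simp: carrier_image)
  then obtain g where "g \<in> P" "Q g" "q g = q f" by force
  thus ?thesis using cong \<open>f \<in> P\<close> by blast
qed

lemma fin_dim_imageI:
  assumes I: "finite I" and b: "\<And>i. i \<in> I \<Longrightarrow> b i \<in> P"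
    and comb: "\<And>f. f \<in> P \<Longrightarrow> \<exists>c. f = (\<lambda>x. \<Sum>i\<in>I. c i * b i x)"
  shows "fin_dim"
proof -
  let ?A = "q ` b ` I"
  have A: "?A \<subseteq> carrier V" using b by (auto simp: carrier_image)
  have sub: "submodule real_ring (span ?A) V" by (rule span_is_submodule[OF A])
  \<comment> \<open>Both memberships are proved together because \<open>q\<close> is known to be
    additive only on \<open>P\<close>.\<close>
  have "(\<lambda>x. \<Sum>i\<in>F. c i * b i x) \<in> P \<and> q (\<lambda>x. \<Sum>i\<in>F. c i * b i x) \<in> span ?A"
    if "finite F" "F \<subseteq> I" for F c
    using that
  proof (induction F rule: finite_induct)
    case empty
    show ?case using zero_mem submodule.zero_closed[OF sub] by (simp add: zero_image)
  next
    case (insert i F)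
    let ?s = "\<lambda>x. \<Sum>i\<in>F. c i * b i x"
    have s: "?s \<in> P" "q ?s \<in> span ?A" using insert by auto
    have i: "b i \<in> P" "q (b i) \<in> span ?A" using insert.prems b in_own_span[OF A] by auto
    have "c i \<odot>\<^bsub>V\<^esub> q (b i) \<in> span ?A"
      by (rule submodule.smult_closed[OF sub _ i(2)]) (simp add: real_ring_def)
    hence "q (\<lambda>x. c i * b i x) \<in> span ?A" using i by (simp add: smult_image)
    from submodule.m_closed[OF sub this s(2)]
    have "q (\<lambda>x. c i * b i x + ?s x) \<in> span ?A"
      using i s smult_mem by (simp add: add_image)
    moreover have "(\<lambda>x. c i * b i x + ?s x) \<in> P"
      using i s by (intro add_mem smult_mem)
    ultimately show ?case using insert.hyps by simp
  qed
  hence "carrier V \<subseteq> span ?A" using comb I unfolding carrier_image by blast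
  hence "gen_set ?A" using span_is_subset2[OF A] by blast
  thus ?thesis unfolding fin_dim_def
    by (intro exI[of _ ?A] conjI finite_imageI I A)
qed

text \<open>\<open>dim\<close> is the least size of a finite generating set, and finite dimension
  ensures that this minimum is attained. The function \<open>r\<close> selects a preimage in
  \<open>P\<close> for each generator.\<close>

lemma gen_set_card_dim:
  assumes "fin_dim"
  obtains A r where "finite A" "card A = dim" "A \<subseteq> carrier V" "gen_set A"
    and "\<And>a. a \<in> A \<Longrightarrow> r a \<in> P" "\<And>a. a \<in> A \<Longrightarrow> q (r a) = a"
proof -
  from assms have "\<exists>n A. finite A \<and> card A = n \<and> A \<subseteq> carrier V \<and> gen_set A"
    by (auto simp: fin_dim_def)
  from LeastI_ex[OF this] obtain A
    where A: "finite A" "card A = dim" "A \<subseteq> carrier V" "gen_set A"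
    unfolding dim_def[symmetric] by blast
  have "a \<in> q ` P" if "a \<in> A" for a using that A(3) carrier_image by blast
  hence "inv_into P q a \<in> P" "q (inv_into P q a) = a" if "a \<in> A" for a
    using that by (simp_all add: inv_into_into f_inv_into_f)
  with A show ?thesis by (rule that)
qed

text \<open>By \<open>cong\<close>, the map \<open>q'\<close> factors through \<open>q\<close>, so
  \<open>V'\<close> is a linear quotient of \<open>V\<close>, and a smallest generating set of
  \<open>V\<close> is carried to a generating set of \<open>V'\<close>.\<close>

lemma dim_quotient_le:
  assumes fin: "fin_dim" and V': "function_image V' q' P"
    and cong: "\<And>f g. f \<in> P \<Longrightarrow> g \<in> P \<Longrightarrow> q f = q g \<Longrightarrow> q' f = q' g"
  shows "real_dim V' \<le> dim"
proof -
  interpret V': function_image V' q' P by fact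
  obtain A r where A: "finite A" "card A = dim" "A \<subseteq> carrier V" "gen_set A"
    and r: "\<And>a. a \<in> A \<Longrightarrow> r a \<in> P" "\<And>a. a \<in> A \<Longrightarrow> q (r a) = a"
    by (rule gen_set_card_dim[OF fin]) blast
  let ?B = "(\<lambda>a. q' (r a)) ` A"
  have B: "?B \<subseteq> carrier V'" using r by (auto simp: V'.carrier_image)
  have sub: "submodule real_ring (V'.span ?B) V'" by (rule V'.span_is_submodule[OF B])
  have "q' f \<in> V'.span ?B" if "f \<in> P" for f
    using that A(4)
  proof (rule gen_set_induct)
    show "q' f \<in> V'.span ?B" if "f \<in> P" "q f \<in> A" for f
    proof -
      have "q' f = q' (r (q f))" using that r by (intro cong) auto
      thus ?thesis using V'.in_own_span[OF B] that by blast
    qed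
    show "q' (\<lambda>x. 0) \<in> V'.span ?B"
      using submodule.zero_closed[OF sub] by (simp add: V'.zero_image)
    show "q' (\<lambda>x. f x + g x) \<in> V'.span ?B"
      if "f \<in> P" "g \<in> P" "q' f \<in> V'.span ?B" "q' g \<in> V'.span ?B" for f g
      using submodule.m_closed[OF sub that(3,4)] that by (simp add: V'.add_image)
    show "q' (\<lambda>x. c * f x) \<in> V'.span ?B" if "f \<in> P" "q' f \<in> V'.span ?B" for c f
      using submodule.smult_closed[OF sub _ that(2), of c] that
      by (simp add: V'.smult_image real_ring_def)
    show "q' g \<in> V'.span ?B"
      if "f \<in> P" "g \<in> P" "q f = q g" "q' f \<in> V'.span ?B" for f g
      using cong[OF that(1-3)] that(4) by simp
  qed (fact A(3))
  hence "V'.gen_set ?B" using V'.span_is_subset2[OF B] by (auto simp: V'.carrier_image)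
  hence "V'.dim \<le> card ?B" using A(1) B by (intro V'.gen_ge_dim) auto
  also have "\<dots> \<le> dim" using card_image_le[OF A(1)] A(2) by metis
  finally show ?thesis .
qed

end


subsection \<open>Spaces of polynomials\<close>

lemma multi_power_in_polys:
  assumes "multi_abs i \<le> m"
  shows "(\<lambda>t. multi_power t i) \<in> polys m"
proof -
  have "(\<lambda>t. multi_power t i) =
      (\<lambda>t. \<Sum>j\<in>{j. multi_abs j \<le> m}. (if j = i then 1 else 0) * multi_power t j)"
    using assms by (auto simp: if_distrib if_distribR finite_multi_abs_le cong: if_cong)
  thus ?thesis by (simp only: polysI)
qed

lemma function_image_polys_L1:
  assumes "\<nu> \<in> representing_measures m \<beta> K"
  shows "function_image (polys_L1 m \<nu>) (ae_class \<nu>) (polys m)"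
proof
  have meas: "p \<in> borel_measurable \<nu>" if "p \<in> polys m" for p
    using polys_integrable[OF assms that] by auto
  show "ae_class \<nu> f \<oplus>\<^bsub>polys_L1 m \<nu>\<^esub> ae_class \<nu> g = ae_class \<nu> (\<lambda>x. f x + g x)"
    if "f \<in> polys m" "g \<in> polys m" for f g
    using L1_space_add[OF meas meas, OF that] by (simp add: polys_L1_def)
  show "c \<odot>\<^bsub>polys_L1 m \<nu>\<^esub> ae_class \<nu> f = ae_class \<nu> (\<lambda>x. c * f x)"
    if "f \<in> polys m" for c f
    using L1_space_smult[OF meas, OF that] by (simp add: polys_L1_def)
qed (simp_all add: polys_L1_def L1_space_def polys_zero polys_add polys_smult)

lemma function_image_polys_restr:
  "function_image (polys_restr m K) (\<lambda>p. restrict p K) (polys m)"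
  by unfold_locales
    (auto simp: polys_restr_def function_space_def polys_zero polys_add polys_smult fun_eq_iff)

lemma fin_dim_polys_image:
  assumes "function_image V q (polys m)"
  shows "vectorspace.fin_dim real_ring V"
proof -
  interpret function_image V q "polys m" by fact
  show ?thesis
  proof (rule fin_dim_imageI[OF finite_multi_abs_le])
    show "(\<lambda>t. multi_power t i) \<in> polys m" if "i \<in> {i. multi_abs i \<le> m}" for i
      using that by (simp add: multi_power_in_polys)
  qed (auto simp: polys_def)
qed


subsection \<open>Supports of measures\<close>

text \<open>The complement is the union of all open null sets; the Lindelof property reduces this to
  a countable union.\<close>

lemma Compl_measure_support_null_set:
  fixes \<nu> :: "'a::second_countable_topology measure"
  assumes sets: "sets \<nu> = sets borel"
  shows "- measure_support \<nu> \<in> null_sets \<nu>"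
proof -
  let ?F = "{U. open U \<and> emeasure \<nu> U = 0}"
  have eq: "- measure_support \<nu> = \<Union>?F"
    by (auto simp: measure_support_def not_gr_zero)
  obtain F where F: "F \<subseteq> ?F" "countable F" "\<Union>F = \<Union>?F"
    using Lindelof[of ?F] by auto
  have "(\<Union>U\<in>F. U) \<in> null_sets \<nu>"
    using F by (intro null_sets_UN') (auto simp: null_sets_def sets)
  thus ?thesis using F eq by simp
qed

text \<open>The complement of the support is null, so \<nu> is the sum of its point masses on a
  finite set. Finiteness of \<nu> turns these masses into real weights.\<close>

lemma finitely_atomic_if_finite_support:
  fixes \<nu> :: "'a::{second_countable_topology, t1_space} measure"
  assumes sets: "sets \<nu> = sets borel" and fin: "finite (measure_support \<nu>)"
    and "finite_measure \<nu>"
  shows "finitely_atomic \<nu>"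
proof -
  interpret finite_measure \<nu> by fact
  let ?S = "measure_support \<nu>"
  note null = Compl_measure_support_null_set[OF sets]
  have [measurable]: "{x} \<in> sets \<nu>" for x by (simp add: sets)
  have eq: "emeasure \<nu> A = (\<Sum>x\<in>?S. emeasure \<nu> {x} * indicator A x)" if "A \<in> sets borel" for A
  proof -
    have [measurable]: "A \<in> sets \<nu>" using that by (simp add: sets)
    have "emeasure \<nu> A = emeasure \<nu> (A \<inter> ?S)"
      using emeasure_Diff_null_set[OF null, of A] by (simp add: Diff_eq)
    also have "\<dots> = (\<Sum>x\<in>A \<inter> ?S. emeasure \<nu> {x})"
      using fin by (intro emeasure_eq_sum_singleton) auto
    also have "\<dots> = (\<Sum>x\<in>?S. emeasure \<nu> {x} * indicator A x)"
      using fin by (intro sum.mono_neutral_cong_left) (auto simp: indicator_def)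
    finally show ?thesis .
  qed
  have pos: "measure \<nu> {x} > 0" if "x \<in> ?S" for x
  proof -
    \<comment> \<open>This open neighbourhood of \<open>x\<close> omits all other support points, so
      it differs from \<open>{x}\<close> only by a null set and the atom inherits its positive
      measure.\<close>
    let ?U = "- (?S - {x})"
    have op: "open ?U" using fin by (intro open_Compl finite_imp_closed) simp
    hence "emeasure \<nu> ?U > 0" using that by (auto simp: measure_support_def)
    also have "emeasure \<nu> ?U = emeasure \<nu> (?U - - ?S)"
      using op by (intro emeasure_Diff_null_set[OF null, symmetric]) (simp add: sets)
    also have "?U - - ?S = {x}" using that by auto
    finally show ?thesis by (simp add: emeasure_eq_measure)
  qed
  obtain xs where xs: "set xs = ?S" "distinct xs" using finite_distinct_list[OF fin] by blast
  have "emeasure \<nu> A = (\<Sum>k<length xs. ennreal (measure \<nu> {xs ! k}) *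
      emeasure (return borel (xs ! k)) A)" if "A \<in> sets borel" for A
  proof -
    have "(\<Sum>x\<in>?S. emeasure \<nu> {x} * indicator A x) =
        (\<Sum>k<length xs. emeasure \<nu> {xs ! k} * indicator A (xs ! k))"
      using xs by (intro sum.reindex_bij_betw[symmetric] bij_betw_nth) auto
    thus ?thesis using eq[OF that] that by (simp add: emeasure_eq_measure)
  qed
  moreover have "\<forall>k<length xs. 0 < measure \<nu> {xs ! k}" using pos xs(1) nth_mem by blast
  ultimately show ?thesis unfolding finitely_atomic_def using sets
    by (intro conjI exI[of _ "length xs"] exI[of _ "\<lambda>k. measure \<nu> {xs ! k}"] exI[of _ "(!) xs"]) auto
qed

lemma disjoint_neighbourhoods:
  fixes S :: "'a::metric_space set"
  assumes "finite S"
  obtains U where "\<And>x. x \<in> S \<Longrightarrow> open (U x) \<and> x \<in> U x" "disjoint_family_on U S"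
proof -
  have "\<exists>e>0. \<forall>y\<in>S. y \<noteq> x \<longrightarrow> e \<le> dist x y" for x
    using finite_set_avoid[OF assms] by blast
  then obtain e where e: "\<And>x. e x > 0" "\<And>x y. y \<in> S \<Longrightarrow> y \<noteq> x \<Longrightarrow> e x \<le> dist x y"
    by metis
  \<comment> \<open>Both radii are at most half of \<open>dist x y\<close>, so a common point would
    violate the triangle inequality.\<close>
  have "False" if "x \<in> S" "y \<in> S" "x \<noteq> y" "z \<in> ball x (e x / 2)" "z \<in> ball y (e y / 2)" for x y z
    using e(2)[of x y] e(2)[of y x] dist_triangle2[of x y z] that by (auto simp: dist_commute)
  hence "disjoint_family_on (\<lambda>x. ball x (e x / 2)) S"
    unfolding disjoint_family_on_def by blast
  thus ?thesis using e(1) by (intro that[of "\<lambda>x. ball x (e x / 2)"]) auto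
qed


subsection \<open>Extreme representing measures\<close>

lemma integrable_bounded_mult:
  fixes f h :: "'a \<Rightarrow> real"
  assumes [measurable]: "h \<in> borel_measurable M" and "\<And>x. \<bar>h x\<bar> \<le> C" and f: "integrable M f"
  shows "integrable M (\<lambda>x. h x * f x)"
proof (rule Bochner_Integration.integrable_bound)
  show "integrable M (\<lambda>x. C * f x)" using f by simp
  have "\<bar>h x * f x\<bar> \<le> \<bar>C * f x\<bar>" for x
    using assms(2)[of x] by (auto simp: abs_mult intro!: mult_right_mono)
  thus "AE x in M. norm (h x * f x) \<le> norm (C * f x)" by simp
qed (use f in auto)

text \<open>The bound on \<open>g\<close> keeps the density nonnegative, each moment changes by the
  integral of \<open>g\<close> times a monomial, which is zero, and null sets of \<nu> stay null, so
  the support does not grow.\<close>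

lemma density_in_representing_measures:
  assumes \<nu>: "\<nu> \<in> representing_measures m \<beta> K"
    and g [measurable]: "g \<in> borel_measurable \<nu>" and bound: "\<And>x. \<bar>g x\<bar> \<le> 1"
    and ann: "\<And>p. p \<in> polys m \<Longrightarrow> (\<integral>t. g t * p t \<partial>\<nu>) = 0"
  shows "density \<nu> (\<lambda>x. ennreal (1 + g x)) \<in> representing_measures m \<beta> K"
proof -
  let ?\<mu> = "density \<nu> (\<lambda>x. ennreal (1 + g x))"
  have sets: "sets \<nu> = sets borel" and supp: "measure_support \<nu> \<subseteq> K"
    using \<nu> by (auto simp: representing_measures_def)
  have nonneg: "0 \<le> 1 + g x" for x using bound[of x] by linarith
  have "integrable ?\<mu> (\<lambda>t. multi_power t i) \<and> \<beta> i = (\<integral>t. multi_power t i \<partial>?\<mu>)"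
    if i: "multi_abs i \<le> m" for i
  proof -
    have int: "integrable \<nu> (\<lambda>t. multi_power t i)" and \<beta>: "\<beta> i = (\<integral>t. multi_power t i \<partial>\<nu>)"
      using \<nu> i by (auto simp: representing_measures_def)
    hence [measurable]: "(\<lambda>t. multi_power t i) \<in> borel_measurable \<nu>" by auto
    have intg: "integrable \<nu> (\<lambda>t. g t * multi_power t i)"
      by (rule integrable_bounded_mult[OF g bound int])
    have "integrable ?\<mu> (\<lambda>t. multi_power t i)"
      using int intg nonneg by (subst integrable_density) (auto simp: distrib_right)
    moreover have "(\<integral>t. multi_power t i \<partial>?\<mu>) =
        (\<integral>t. multi_power t i + g t * multi_power t i \<partial>\<nu>)"
      using nonneg by (subst integral_density) (auto simp: distrib_right)
    hence "(\<integral>t. multi_power t i \<partial>?\<mu>) = \<beta> i"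
      using int intg ann[OF multi_power_in_polys[OF i]] \<beta> by simp
    ultimately show ?thesis by simp
  qed
  moreover have "measure_support ?\<mu> \<subseteq> measure_support \<nu>"
  proof -
    have "emeasure ?\<mu> U = 0" if "open U" "emeasure \<nu> U = 0" for U
    proof -
      have "U \<in> null_sets \<nu>" using that by (simp add: null_sets_def sets)
      hence "U \<in> null_sets ?\<mu>"
        by (auto simp: null_sets_density_iff intro: AE_not_in eventually_mono[OF AE_not_in])
      thus ?thesis by auto
    qed
    thus ?thesis unfolding measure_support_def by (auto simp: zero_less_iff_neq_zero)
  qed
  ultimately show ?thesis using sets supp by (auto simp: representing_measures_def)
qed

text \<open>After rescaling \<open>h\<close> to \<open>g\<close>, \<nu> is the midpoint of the
  measures with densities \<open>1 + g\<close> and \<open>1 - g\<close>. Extremality makes these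
  equal, and almost everywhere uniqueness of densities gives \<open>g = 0\<close>.\<close>

lemma extreme_measure_annihilator:
  assumes ext: "extreme_measure \<nu> (representing_measures m \<beta> K)"
    and h [measurable]: "h \<in> borel_measurable \<nu>" and bound: "\<And>x. \<bar>h x\<bar> \<le> C"
    and ann: "\<And>p. p \<in> polys m \<Longrightarrow> (\<integral>t. h t * p t \<partial>\<nu>) = 0"
  shows "AE x in \<nu>. h x = 0"
proof -
  have \<nu>: "\<nu> \<in> representing_measures m \<beta> K" using ext by (simp add: extreme_measure_def)
  interpret finite_measure \<nu> using representing_measures_finite[OF \<nu>] .
  have C: "0 \<le> C" using bound[of undefined] by linarith
  \<comment> \<open>Dividing by \<open>1 + C\<close> instead of \<open>C\<close> stays meaningful
    when \<open>C = 0\<close>.\<close>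
  define g where "g x = h x / (1 + C)" for x
  have [measurable]: "g \<in> borel_measurable \<nu>" unfolding g_def by measurable
  have g: "\<bar>g x\<bar> \<le> 1" for x using bound[of x] C by (simp add: g_def abs_divide)
  have nonneg: "0 \<le> 1 + g x" "0 \<le> 1 - g x" for x 
    using g[of x] by (simp_all add: abs_le_iff)
  have anng: "(\<integral>t. g t * p t \<partial>\<nu>) = 0" if "p \<in> polys m" for p
    using ann[OF that] by (simp add: g_def)
  let ?\<mu>1 = "density \<nu> (\<lambda>x. ennreal (1 + g x))" and ?\<mu>2 = "density \<nu> (\<lambda>x. ennreal (1 - g x))"
  have \<mu>1: "?\<mu>1 \<in> representing_measures m \<beta> K"
    using g anng by (intro density_in_representing_measures[OF \<nu>]) auto
  have "density \<nu> (\<lambda>x. ennreal (1 + (- g x))) \<in> representing_measures m \<beta> K"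
    using g anng by (intro density_in_representing_measures[OF \<nu>]) auto
  hence \<mu>2: "?\<mu>2 \<in> representing_measures m \<beta> K" by simp
  have mid: "emeasure \<nu> A = ennreal (1 - 1/2) * emeasure ?\<mu>1 A + ennreal (1/2) * emeasure ?\<mu>2 A"
    if [measurable]: "A \<in> sets \<nu>" for A
  proof -
    have "ennreal (1 + g x) + ennreal (1 - g x) = 2" for x
      using nonneg[of x] by (simp flip: ennreal_plus)
    hence "ennreal (1 + g x) * indicator A x + ennreal (1 - g x) * indicator A x
        = 2 * indicator A x" for x
      by (simp flip: distrib_right)
    hence "emeasure ?\<mu>1 A + emeasure ?\<mu>2 A = 2 * emeasure \<nu> A"
      by (simp add: emeasure_density nn_integral_cmult flip: nn_integral_add)
    hence "ennreal (1/2) * (emeasure ?\<mu>1 A + emeasure ?\<mu>2 A) =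
        (ennreal (1/2) * ennreal 2) * emeasure \<nu> A" by (simp add: mult.assoc)
    also have "ennreal (1/2) * ennreal 2 = 1" by (subst ennreal_mult[symmetric]) auto
    finally show ?thesis by (simp add: distrib_left)
  qed
  have "?\<mu>1 = ?\<mu>2"
  proof -
    have "\<forall>\<mu>1\<in>representing_measures m \<beta> K. \<forall>\<mu>2\<in>representing_measures m \<beta> K. \<forall>u::real.
        0 < u \<and> u < 1 \<and> (\<forall>A\<in>sets \<nu>. emeasure \<nu> A =
          ennreal (1 - u) * emeasure \<mu>1 A + ennreal u * emeasure \<mu>2 A) \<longrightarrow> \<mu>1 = \<mu>2"
      using ext by (simp add: extreme_measure_def)
    from this[rule_format, OF \<mu>1 \<mu>2, of "1/2"] mid show ?thesis by auto
  qed
  hence "AE x in \<nu>. ennreal (1 + g x) = ennreal (1 - g x)"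
    by (subst (asm) density_unique_iff) auto
  thus ?thesis
    by eventually_elim (use nonneg C in \<open>simp add: g_def\<close>)
qed

text \<open>It suffices to test \<open>h\<close> against representatives of a generating set of size
  \<open>dim\<close>: this gives finitely many equations, fewer than the unknowns, and linearity
  extends the vanishing to all of \<open>polys m\<close>.\<close>

lemma extreme_measure_disjoint_family_card:
  assumes ext: "extreme_measure \<nu> (representing_measures m \<beta> K)"
    and S: "finite S" and A [measurable]: "\<And>k. k \<in> S \<Longrightarrow> A k \<in> sets \<nu>"
    and disj: "disjoint_family_on A S" and pos: "\<And>k. k \<in> S \<Longrightarrow> emeasure \<nu> (A k) > 0"
  shows "card S \<le> real_dim (polys_L1 m \<nu>)"
proof (rule ccontr)
  assume less: "\<not> ?thesis"
  have \<nu>: "\<nu> \<in> representing_measures m \<beta> K" using ext by (simp add: extreme_measure_def)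
  interpret function_image "polys_L1 m \<nu>" "ae_class \<nu>" "polys m"
    by (rule function_image_polys_L1[OF \<nu>])
  obtain B r where B: "finite B" "card B = dim" "B \<subseteq> carrier (polys_L1 m \<nu>)" "gen_set B"
    and r: "\<And>b. b \<in> B \<Longrightarrow> r b \<in> polys m" "\<And>b. b \<in> B \<Longrightarrow> ae_class \<nu> (r b) = b"
    by (rule gen_set_card_dim[OF fin_dim_polys_image[OF function_image_axioms]]) blast
  obtain x where x: "\<exists>k\<in>S. x k \<noteq> 0"
    "\<And>b. b \<in> B \<Longrightarrow> (\<Sum>k\<in>S. (\<integral>t. indicator (A k) t * r b t \<partial>\<nu>) * x k) = 0"
    using underdetermined_homogeneous_system[OF B(1) S, of "\<lambda>b k. \<integral>t. indicator (A k) t * r b t \<partial>\<nu>"]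
      less B(2) by auto
  \<comment> \<open>The step function whose values on the sets \<open>A k\<close> form the
    nontrivial solution.\<close>
  define h where "h t = (\<Sum>k\<in>S. x k * indicator (A k) t)" for t
  have h [measurable]: "h \<in> borel_measurable \<nu>" unfolding h_def by measurable
  have bound: "\<bar>h t\<bar> \<le> (\<Sum>k\<in>S. \<bar>x k\<bar>)" for t
    unfolding h_def by (rule order_trans[OF sum_abs]) (auto intro!: sum_mono simp: indicator_def)
  have int: "integrable \<nu> (\<lambda>t. h t * p t)" if "p \<in> polys m" for p
    by (rule integrable_bounded_mult[OF h bound polys_integrable[OF \<nu> that]])
  \<comment> \<open>Pairing with \<open>h\<close> is well defined on classes, which allows passing
    from a polynomial to the chosen representative of its class.\<close>
  have cong: "(\<integral>t. h t * p t \<partial>\<nu>) = (\<integral>t. h t * p' t \<partial>\<nu>)"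
    if "p \<in> polys m" "p' \<in> polys m" "ae_class \<nu> p = ae_class \<nu> p'" for p p'
  proof -
    have [measurable]: "p \<in> borel_measurable \<nu>" "p' \<in> borel_measurable \<nu>"
      using polys_integrable[OF \<nu>] that by auto
    have "AE t in \<nu>. p t = p' t" using that by (simp add: ae_class_eq_iff)
    hence "AE t in \<nu>. h t * p t = h t * p' t" by eventually_elim simp
    thus ?thesis by (intro integral_cong_AE) auto
  qed
  have base: "(\<integral>t. h t * r b t \<partial>\<nu>) = 0" if "b \<in> B" for b
  proof -
    have "integrable \<nu> (\<lambda>t. indicator (A k) t * r b t)" if "k \<in> S" for k
      using integrable_mult_indicator[OF A[OF that] polys_integrable[OF \<nu> r(1)[OF \<open>b \<in> B\<close>]]] by simp
    hence "(\<integral>t. (\<Sum>k\<in>S. x k * (indicator (A k) t * r b t)) \<partial>\<nu>) =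
        (\<Sum>k\<in>S. x k * (\<integral>t. indicator (A k) t * r b t \<partial>\<nu>))"
      by (subst Bochner_Integration.integral_sum) auto
    thus ?thesis using x(2)[OF that] 
      by (simp add: h_def sum_distrib_right mult.assoc mult.commute[of _ "x _"])
  qed
  have "(\<integral>t. h t * p t \<partial>\<nu>) = 0" if "p \<in> polys m" for p
    using that B(4)
  proof (rule gen_set_induct)
    show "(\<integral>t. h t * f t \<partial>\<nu>) = 0" if "f \<in> polys m" "ae_class \<nu> f \<in> B" for f
      using cong[OF that(1) r(1)[OF that(2)]] r(2)[OF that(2)] base[OF that(2)] by simp
    show "(\<integral>t. h t * (f t + g t) \<partial>\<nu>) = 0"
      if "f \<in> polys m" "g \<in> polys m" "(\<integral>t. h t * f t \<partial>\<nu>) = 0" "(\<integral>t. h t * g t \<partial>\<nu>) = 0" for f g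
      using int[OF that(1)] int[OF that(2)] that(3,4) by (simp add: distrib_left)
    show "(\<integral>t. h t * (c * f t) \<partial>\<nu>) = 0" if "(\<integral>t. h t * f t \<partial>\<nu>) = 0" for c f
      using that by (simp add: mult.left_commute[of _ c])
    show "(\<integral>t. h t * g t \<partial>\<nu>) = 0"
      if "f \<in> polys m" "g \<in> polys m" "ae_class \<nu> f = ae_class \<nu> g" "(\<integral>t. h t * f t \<partial>\<nu>) = 0" for f g
      using cong[OF that(1-3)] that(4) by simp
  qed (use B(3) in simp_all)
  hence h0: "AE t in \<nu>. h t = 0" by (rule extreme_measure_annihilator[OF ext h bound])
  obtain k where k: "k \<in> S" "x k \<noteq> 0" using x(1) by blast
  \<comment> \<open>By disjointness only the summand of \<open>k\<close> survives on
    \<open>A k\<close>, so \<open>h\<close> is nonzero on a set of positive measure.\<close>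
  have "h t = x k" if "t \<in> A k" for t
  proof -
    have "x j * indicator (A j) t = (if j = k then x k else 0)" if "j \<in> S" for j
      using disjoint_family_onD[OF disj that k(1)] \<open>t \<in> A k\<close> by (auto simp: indicator_def)
    thus ?thesis using S k by (simp add: h_def)
  qed
  hence "AE t in \<nu>. t \<notin> A k" using h0 k(2) by (auto elim!: eventually_mono)
  hence "emeasure \<nu> (A k) = 0" using AE_iff_null_sets[OF A[OF k(1)]] by (auto dest: null_setsD1)
  thus False using pos[OF k(1)] by simp
qed

text \<open>Polynomials that agree on \<open>K\<close> agree on the support of \<nu>, hence almost
  everywhere, so the class map factors through restriction to \<open>K\<close>.\<close>

lemma polys_L1_dim_le_restr:
  fixes \<nu> :: "(real ^ 'd) measure"
  assumes \<nu>: "\<nu> \<in> representing_measures m \<beta> K"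
  shows "real_dim (polys_L1 m \<nu>) \<le> real_dim (polys_restr m K)"
proof -
  note restr = function_image_polys_restr[of m K]
  show ?thesis
  proof (rule function_image.dim_quotient_le[OF restr fin_dim_polys_image[OF restr]
        function_image_polys_L1[OF \<nu>]])
    fix f g :: "real ^ 'd \<Rightarrow> real"
    assume fg: "f \<in> polys m" "g \<in> polys m" "restrict f K = restrict g K"
    have "sets \<nu> = sets borel" and supp: "measure_support \<nu> \<subseteq> K"
      using \<nu> by (auto simp: representing_measures_def)
    from AE_not_in[OF Compl_measure_support_null_set[OF this(1)]]
    have "AE t in \<nu>. f t = g t"
    proof eventually_elim
      case (elim t)
      hence "t \<in> K" using supp by auto
      thus ?case using fun_cong[OF fg(3), of t] by simp
    qed
    thus "ae_class \<nu> f = ae_class \<nu> g"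
      using polys_integrable[OF \<nu>] fg by (subst ae_class_eq_iff) auto
  qed
qed

theorem proposition2p3:
  fixes m :: nat
    and \<beta> :: "nat ^ 'd \<Rightarrow> real"
    and K :: "(real ^ 'd) set"
    and \<nu> :: "(real ^ 'd) measure"
  assumes "closed K"
    and "extreme_measure \<nu> (representing_measures m \<beta> K)"
  shows "finitely_atomic \<nu> \<and>
         finite (measure_support \<nu>) \<and>
         card (measure_support \<nu>) \<le> real_dim (polys_L1 m \<nu>) \<and>
         real_dim (polys_L1 m \<nu>) \<le> real_dim (polys_restr m K)"
proof -
  have \<nu>: "\<nu> \<in> representing_measures m \<beta> K" using assms(2) by (simp add: extreme_measure_def)
  hence sets: "sets \<nu> = sets borel" by (simp add: representing_measures_def)
  \<comment> \<open>The bound is first shown for finite subsets, since finiteness of the support is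
    not yet known.\<close>
  have bound: "card S \<le> real_dim (polys_L1 m \<nu>)" if S: "finite S" "S \<subseteq> measure_support \<nu>" for S
  proof -
    obtain U where U: "\<And>x. x \<in> S \<Longrightarrow> open (U x) \<and> x \<in> U x" "disjoint_family_on U S"
      by (rule disjoint_neighbourhoods[OF S(1)]) blast
    show ?thesis
    proof (rule extreme_measure_disjoint_family_card[OF assms(2) S(1) _ U(2)])
      fix x assume x: "x \<in> S"
      show "U x \<in> sets \<nu>" using U(1)[OF x] by (simp add: sets)
      show "emeasure \<nu> (U x) > 0" using U(1)[OF x] x S(2) by (auto simp: measure_support_def)
    qed
  qed
  \<comment> \<open>An infinite support would contain finite subsets of every size, contradicting
    the uniform bound.\<close>
  have fin: "finite (measure_support \<nu>)"
    by (rule ccontr) (metis bound infinite_arbitrarily_large not_less_eq_eq)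
  thus ?thesis
    using finitely_atomic_if_finite_support[OF sets fin representing_measures_finite[OF \<nu>]]
      bound[OF fin order.refl] polys_L1_dim_le_restr[OF \<nu>]
    by blast
qed

end
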